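(* Let $d\ge 2$, let $T=L_1+L_1^*$ act in the full Fock space $\mathcal F_d$, and let $\mu_T$ be the limiting eigenvalue distribution of the truncations $T_N=P_NTP_N$. Then $\mu_T$ is a countable sum of atoms, given explicitly by $$\mu_T=\left(1-\frac1d\right)^2\sum_{h=0}^\infty\left(\frac1d\right)^h\mu_h .$$
   Context: The Fock space on $d$ generators is the Hilbert space direct sum $\mathcal F_d=\bigoplus_{n=0}^\infty \mathcal H_n$ with $\mathcal H_0=\mathbb C$ and $\mathcal H_n=(\mathbb C^d)^{\otimes n}$ for $n\ge 1$. Let $e_1,\dots,e_d$ be the standard basis of $\mathbb C^d$. For a word $w=i_1\cdots i_n$ in the letters $\{1,\dots,d\}$ of length $|w|=n$, put $\xi_w=e_{i_1}\otimes\cdots\otimes e_{i_n}$ (for the empty word, $\xi_w=1\in\mathcal H_0$); the $\xi_w$ form an orthonormal basis of $\mathcal F_d$. The left shifts are the isometries $L_i\xi=e_i\otimes\xi$ (i.e. $L_i\xi_w=\xi_{iw}$), $i=1,\dots,d$. $P_N$ is the orthogonal projection onto $\mathrm{span}\{\xi_w:|w|\le N\}$, of rank $d_N=1+d+\cdots+d^N$, and $T_N=P_NTP_N$ is regarded as an operator on the range of $P_N$. For a bounded self-adjoint operator $T$ on $\mathcal F_d$, the limiting eigenvalue distribution of the truncations $T_N$ is the unique Borel probability measure $\mu_T$ on $\mathbb R$ (when it exists) such that $\lim_{N\to\infty}\frac1{d_N}\sum_{i=1}^{d_N}f(\lambda_i^{(N)})=\int_{\mathbb R} f\,d\mu_T$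 for every continuous $f:\mathbb R\to\mathbb C$, where $\lambda_1^{(N)},\dots,\lambda_{d_N}^{(N)}$ are the eigenvalues of $T_N$ with multiplicity. It exists whenever $d\ge2$ and $T$ is bounded, self-adjoint and multi-Toeplitz, meaning $R_i^*TR_j=\delta_{ij}T$ for all $i,j$, where $R_i\xi=\xi\otimes e_i$; the operator $L_1+L_1^*$ is of this kind. For $h\ge 0$, $X_h$ is the $(h+1)\times(h+1)$ matrix whose $(i,j)$ entry is $1$ if $|i-j|=1$ and $0$ otherwise, and $\mu_h$ is its eigenvalue counting measure, $\mu_h=\sum_{j=1}^{h+1}\delta_{\alpha_{j,h}}$ with $\alpha_{j,h}=2\cos\frac{j\pi}{h+2}$ (so $\mu_h$ has total mass $h+1$ and $\mu_0=\delta_0$). *)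

theory Defs
  imports
    "HOL-Probability.Probability"
    "HOL-Library.Function_Algebras"
    "Jordan_Normal_Form.Char_Poly"
begin

section \<open>The full Fock space\<close>

text \<open>
  The summand \<open>(C^d)^{\<otimes>n}\<close> is realised as the space of complex functions on the words of
  length \<open>n\<close> in the letters \<open>1, ..., d\<close>, i.e. by coordinates with respect to the tensors
  \<open>e_{i_1} \<otimes> ... \<otimes> e_{i_n}\<close>. The Hilbert space direct sum over all \<open>n\<close> is then the space of
  square-summable functions on all words. Vectors live in the ambient type
  \<open>nat list \<Rightarrow> complex\<close>, with \<open>fock d\<close> as carrier.
\<close>

definition words :: "nat \<Rightarrow> nat list set" where
  "words d = lists {1..d}"

definition fock :: "nat \<Rightarrow> (nat list \<Rightarrow> complex) set" where
  "fock d = {\<xi>. (\<forall>w. w \<notin> words d \<longrightarrow> \<xi> w = 0) \<and> (\<lambda>w. (cmod (\<xi> w))\<^sup>2) summable_on UNIV}"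

definition finner :: "(nat list \<Rightarrow> complex) \<Rightarrow> (nat list \<Rightarrow> complex) \<Rightarrow> complex" where
  "finner \<xi> \<eta> = (\<Sum>\<^sub>\<infinity>w. \<xi> w * cnj (\<eta> w))"

definition fscale :: "complex \<Rightarrow> (nat list \<Rightarrow> complex) \<Rightarrow> (nat list \<Rightarrow> complex)" where
  "fscale c \<xi> = (\<lambda>w. c * \<xi> w)"

global_interpretation fsp: Vector_Spaces.vector_space fscale
  by standard (auto simp: fscale_def fun_eq_iff algebra_simps)

definition basis_vec :: "nat list \<Rightarrow> (nat list \<Rightarrow> complex)" where
  "basis_vec w = (\<lambda>v. if v = w then 1 else 0)"

text \<open>
  In coordinates, the tensor product \<open>H_m \<times> H_n \<rightarrow> H_{m+n}\<close> is \<open>(\<xi> \<otimes> \<eta>)(uv) = \<xi>(u) \<eta>(v)\<close>;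
  extended bilinearly to the direct sum, it becomes a sum over all splittings of a word.
\<close>

definition tensor ::
    "(nat list \<Rightarrow> complex) \<Rightarrow> (nat list \<Rightarrow> complex) \<Rightarrow> (nat list \<Rightarrow> complex)" where
  "tensor \<xi> \<eta> = (\<lambda>w. \<Sum>k\<le>length w. \<xi> (take k w) * \<eta> (drop k w))"

lemma tensor_basis_vec: "tensor (basis_vec u) (basis_vec v) = basis_vec (u @ v)"
proof
  fix w
  have iff: "take k w = u \<and> drop k w = v \<longleftrightarrow> k = length u \<and> w = u @ v" if "k \<le> length w" for k
    using that by (metis append_eq_conv_conj append_take_drop_id length_take min.absorb2)
  have "tensor (basis_vec u) (basis_vec v) w =
      (\<Sum>k\<le>length w. if take k w = u \<and> drop k w = v then 1 else 0)"
    unfolding tensor_def basis_vec_def by (rule sum.cong) simp_all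
  also have "\<dots> = (\<Sum>k\<le>length w. if k = length u then (if w = u @ v then 1 else 0) else 0)"
    by (rule sum.cong[OF refl]) (simp add: iff)
  also have "\<dots> = basis_vec (u @ v) w"
    unfolding sum.delta'[OF finite_atMost] sum.delta[OF finite_atMost]
    by (simp add: basis_vec_def)
  finally show "tensor (basis_vec u) (basis_vec v) w = basis_vec (u @ v) w" .
qed

definition lshift :: "nat \<Rightarrow> (nat list \<Rightarrow> complex) \<Rightarrow> (nat list \<Rightarrow> complex)" where
  "lshift i \<xi> = tensor (basis_vec [i]) \<xi>"

text \<open>The adjoint, for bounded operators on \<open>fock d\<close>; only its values on \<open>fock d\<close> are meaningful.\<close>

definition fadjoint ::
    "nat \<Rightarrow> ((nat list \<Rightarrow> complex) \<Rightarrow> (nat list \<Rightarrow> complex)) \<Rightarrow>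
      (nat list \<Rightarrow> complex) \<Rightarrow> (nat list \<Rightarrow> complex)" where
  "fadjoint d A \<eta> = (THE \<zeta>. \<zeta> \<in> fock d \<and> (\<forall>\<xi>\<in>fock d. finner (A \<xi>) \<eta> = finner \<xi> \<zeta>))"

section \<open>Truncations and their limiting eigenvalue distribution\<close>

definition trunc_space :: "nat \<Rightarrow> nat \<Rightarrow> (nat list \<Rightarrow> complex) set" where
  "trunc_space d N = fsp.span (basis_vec ` {w \<in> words d. length w \<le> N})"

definition orth_proj ::
    "(nat list \<Rightarrow> complex) set \<Rightarrow> (nat list \<Rightarrow> complex) \<Rightarrow> (nat list \<Rightarrow> complex)" where
  "orth_proj S \<xi> = (THE \<eta>. \<eta> \<in> S \<and> (\<forall>\<zeta>\<in>S. finner (\<xi> - \<eta>) \<zeta> = 0))"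

definition truncation ::
    "nat \<Rightarrow> nat \<Rightarrow> ((nat list \<Rightarrow> complex) \<Rightarrow> (nat list \<Rightarrow> complex)) \<Rightarrow>
      (nat list \<Rightarrow> complex) \<Rightarrow> (nat list \<Rightarrow> complex)" where
  "truncation d N T = (\<lambda>\<xi>. orth_proj (trunc_space d N) (T (orth_proj (trunc_space d N) \<xi>)))"

text \<open>Eigenspaces of the truncation as an operator on the range of the projection.\<close>

definition trunc_eigenspace ::
    "nat \<Rightarrow> nat \<Rightarrow> ((nat list \<Rightarrow> complex) \<Rightarrow> (nat list \<Rightarrow> complex)) \<Rightarrow> complex \<Rightarrow>
      (nat list \<Rightarrow> complex) set" where
  "trunc_eigenspace d N T c = {\<xi> \<in> trunc_space d N. truncation d N T \<xi> = fscale c \<xi>}"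

text \<open>
  The notion is meant for bounded self-adjoint \<open>T\<close>: the truncations are then self-adjoint, so all
  their eigenvalues are real, and the multiplicity is the dimension of the eigenspace.
\<close>

definition is_limiting_eigenvalue_distribution ::
    "nat \<Rightarrow> ((nat list \<Rightarrow> complex) \<Rightarrow> (nat list \<Rightarrow> complex)) \<Rightarrow> real measure \<Rightarrow> bool" where
  "is_limiting_eigenvalue_distribution d T \<mu> \<longleftrightarrow>
     prob_space \<mu> \<and> sets \<mu> = sets borel \<and>
     (\<forall>f :: real \<Rightarrow> complex. continuous_on UNIV f \<longrightarrow>
        integrable \<mu> f \<and>
        (\<lambda>N. (\<Sum>l | trunc_eigenspace d N T (complex_of_real l) \<noteq> {0}.
                of_nat (fsp.dim (trunc_eigenspace d N T (complex_of_real l))) * f l)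
              / of_nat (\<Sum>k\<le>N. d ^ k))
          \<longlonglongrightarrow> (LINT x|\<mu>. f x))"

definition limiting_eigenvalue_distribution ::
    "nat \<Rightarrow> ((nat list \<Rightarrow> complex) \<Rightarrow> (nat list \<Rightarrow> complex)) \<Rightarrow> real measure" where
  "limiting_eigenvalue_distribution d T = (THE \<mu>. is_limiting_eigenvalue_distribution d T \<mu>)"

section \<open>Sums of measures and the atomic measures\<close>

definition sum_measure :: "'i set \<Rightarrow> ('i \<Rightarrow> real measure) \<Rightarrow> real measure" where
  "sum_measure I M =
     measure_of UNIV (sets borel) (\<lambda>A. \<integral>\<^sup>+i. emeasure (M i) A \<partial>count_space I)"

lemma sets_sum_measure [simp]: "sets (sum_measure I M) = sets borel"
  unfolding sum_measure_def using sets.sigma_sets_eq[of "borel :: real measure"] by simp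

lemma emeasure_sum_measure:
  assumes "\<And>i. i \<in> I \<Longrightarrow> sets (M i) = sets borel" and "A \<in> sets borel"
  shows "emeasure (sum_measure I M) A = (\<integral>\<^sup>+i. emeasure (M i) A \<partial>count_space I)"
proof (rule emeasure_measure_of[OF sum_measure_def])
  show "countably_additive (sets (sum_measure I M))
          (\<lambda>A. \<integral>\<^sup>+i. emeasure (M i) A \<partial>count_space I)"
  proof (rule countably_additiveI)
    fix B :: "nat \<Rightarrow> real set"
    assume B: "range B \<subseteq> sets (sum_measure I M)" "disjoint_family B"
    have "(\<Sum>n. \<integral>\<^sup>+i. emeasure (M i) (B n) \<partial>count_space I) =
          (\<integral>\<^sup>+i. (\<Sum>n. emeasure (M i) (B n)) \<partial>count_space I)"
      by (rule nn_integral_suminf[symmetric]) simp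
    also have "\<dots> = (\<integral>\<^sup>+i. emeasure (M i) (\<Union> (range B)) \<partial>count_space I)"
      using B assms(1) by (intro nn_integral_cong suminf_emeasure) auto
    finally show "(\<Sum>n. \<integral>\<^sup>+i. emeasure (M i) (B n) \<partial>count_space I) =
        (\<integral>\<^sup>+i. emeasure (M i) (\<Union> (range B)) \<partial>count_space I)" .
  qed
qed (use assms(2) in \<open>auto simp: positive_def\<close>)

definition path_mat :: "nat \<Rightarrow> real mat" where
  "path_mat h = mat (h + 1) (h + 1) (\<lambda>(i, j). if i = j + 1 \<or> j = i + 1 then 1 else 0)"

text \<open>
  Each eigenvalue weighted with its algebraic multiplicity; for a real symmetric matrix all
  eigenvalues are real, so nothing is lost by working over the reals.
\<close>

definition eigenvalue_counting_measure :: "real mat \<Rightarrow> real measure" where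
  "eigenvalue_counting_measure A =
     sum_measure {l. eigenvalue A l}
       (\<lambda>l. scale_measure (of_nat (Polynomial.order l (char_poly A))) (return borel l))"

definition path_measure :: "nat \<Rightarrow> real measure" where
  "path_measure h = eigenvalue_counting_measure (path_mat h)"

end

theory Submission
  imports Defs
begin

text \<open>
  On basis vectors, \<open>L\<^sub>1\<close> puts the letter 1 in front of a word and \<open>L\<^sub>1\<^sup>*\<close> removes it. The words of
  length at most \<open>N\<close> therefore fall into chains \<open>v, 1v, 11v, ..., 1\<^sup>hv\<close>, one for each word \<open>v\<close>
  that does not begin with 1, where \<open>h = N - |v|\<close>; the truncation \<open>T\<^sub>N\<close> leaves the span of every
  chain invariant and acts on it as the path matrix \<open>X\<^sub>h\<close>.

  The eigenvalue equation along a chain is the three-term recursion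
  \<open>a\<^sub>k\<^sub>+\<^sub>1 = l a\<^sub>k - a\<^sub>k\<^sub>-\<^sub>1\<close> of the Chebyshev polynomials, with boundary condition
  \<open>a\<^sub>h\<^sub>+\<^sub>1 = 0\<close> at the end of the chain. Hence \<open>l\<close> is an eigenvalue on a chain with \<open>h + 1\<close> vertices
  iff \<open>U\<^sub>h\<^sub>+\<^sub>1(l/2) = 0\<close>, and then with a one-dimensional eigenspace (\<open>eigenvector_on_chain\<close>,
  \<open>dim_trunc_eigenspace\<close>). The roots are \<open>2 cos (j\<pi>/(h+2))\<close>, and comparing their number with the
  degree of the characteristic polynomial shows that they are all the eigenvalues of \<open>X\<^sub>h\<close>
  and that they are simple (\<open>path_spectrum\<close>).

  There are \<open>(d - 1) d\<^sup>m\<^sup>-\<^sup>1\<close> words \<open>v\<close> of length \<open>m \<ge> 1\<close> that do not begin with 1, and one of length 0.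
  Divided by \<open>d\<^sub>N\<close>, the number of chains with \<open>h + 1\<close> vertices tends to
  \<open>(1 - 1/d)\<^sup>2 d\<^sup>-\<^sup>h\<close>. In fact, with \<open>q = 1/d\<close>, the eigenvalue average of a test function is, up to the
  factor \<open>1/(1 - q\<^sup>N\<^sup>+\<^sup>1)\<close> and one vanishing term, a partial sum of the series for its integral
  against the atomic measure (\<open>eigenvalue_average\<close>), so that the limit needs no
  interchange of limit and sum. Uniqueness of the limiting distribution is the uniqueness theorem
  for characteristic functions, since the functions \<open>x \<mapsto> exp(itx)\<close> are among the test functions.
\<close>

section \<open>The spectrum of the path matrix\<close>

text \<open>
  \<open>chebU n x\<close> is \<open>U\<^sub>n(x/2)\<close>, where \<open>U\<^sub>n\<close> is the Chebyshev polynomial of the second kind.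
\<close>

fun chebU :: "nat \<Rightarrow> real \<Rightarrow> real" where
  "chebU 0 x = 1"
| "chebU (Suc 0) x = x"
| "chebU (Suc (Suc n)) x = x * chebU (Suc n) x - chebU n x"

lemma sin_times_chebU: "sin t * chebU n (2 * cos t) = sin (real (n + 1) * t)"
proof (induction n rule: less_induct)
  case (less n)
  consider "n = 0" | "n = 1" | m where "n = Suc (Suc m)"
    by (metis One_nat_def not0_implies_Suc)
  then show ?case
  proof cases
    case 1
    then show ?thesis by simp
  next
    case 2
    then show ?thesis using sin_double[of t] by (simp add: mult_ac)
  next
    case 3
    have "sin t * chebU n (2 * cos t) = 2 * cos t * sin (real (m + 2) * t) - sin (real (m + 1) * t)"
      using less.IH[of m] less.IH[of "Suc m"] 3 by (simp add: algebra_simps)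
    also have "\<dots> = sin (real (n + 1) * t)"
    proof -
      have "sin (real (m + 2) * t + t) + sin (real (m + 2) * t - t) = 2 * cos t * sin (real (m + 2) * t)"
        by (simp add: sin_add sin_diff)
      moreover have "real (m + 2) * t + t = real (n + 1) * t" "real (m + 2) * t - t = real (m + 1) * t"
        using 3 by (simp_all add: algebra_simps)
      ultimately show ?thesis by simp
    qed
    finally show ?thesis .
  qed
qed

definition path_angle :: "nat \<Rightarrow> nat \<Rightarrow> real" where
  "path_angle h j = real j * pi / real (h + 2)"

definition path_root :: "nat \<Rightarrow> nat \<Rightarrow> real" where
  "path_root h j = 2 * cos (path_angle h j)"

lemma path_angle_bounds:
  assumes "j \<in> {1..h + 1}"
  shows "0 < path_angle h j" and "path_angle h j < pi"
proof -
  have "real j < real (h + 2)" using assms by auto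
  then have "real j * pi < real (h + 2) * pi" by (rule mult_strict_right_mono) simp
  then show "path_angle h j < pi"
    unfolding path_angle_def by (simp only: pos_divide_less_eq of_nat_0_less_iff) (simp add: mult.commute)
  show "0 < path_angle h j"
    unfolding path_angle_def using assms by (intro divide_pos_pos mult_pos_pos) auto
qed

lemma inj_on_path_root: "inj_on (path_root h) {1..h + 1}"
proof (rule inj_onI)
  fix i j assume i: "i \<in> {1..h + 1}" and j: "j \<in> {1..h + 1}" and eq: "path_root h i = path_root h j"
  have cos: "cos (path_angle h i) = cos (path_angle h j)"
    using eq by (simp add: path_root_def)
  have "path_angle h i = path_angle h j"
    by (rule cos_inj_pi[OF _ _ _ _ cos])
      (use path_angle_bounds[OF i] path_angle_bounds[OF j] in linarith)+
  then have "real i * pi = real j * pi"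
    unfolding path_angle_def by (simp only: divide_cancel_right of_nat_eq_0_iff) simp
  then show "i = j" by simp
qed

text \<open>
  The numerator \<open>sin ((h + 2) t)\<close> of \<open>U\<^sub>h\<^sub>+\<^sub>1(cos t)\<close> vanishes at \<open>t = j\<pi>/(h + 2)\<close>, while the
  denominator \<open>sin t\<close> does not.
\<close>

lemma chebU_path_root:
  assumes "j \<in> {1..h + 1}"
  shows "chebU (h + 1) (path_root h j) = 0"
proof -
  define t where "t = path_angle h j"
  have "0 < t" "t < pi" using path_angle_bounds[OF assms] by (simp_all add: t_def)
  then have "sin t \<noteq> 0" using sin_gt_zero by force
  moreover have "real (h + 1 + 1) * t = real j * pi"
    by (simp add: t_def path_angle_def field_simps)
  moreover have "path_root h j = 2 * cos t"
    by (simp only: path_root_def t_def)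
  ultimately show ?thesis
    using sin_times_chebU[of t "h + 1"] sin_npi[of j] by simp
qed

lemma path_mat_carrier: "path_mat h \<in> carrier_mat (h + 1) (h + 1)"
  by (simp add: path_mat_def)

text \<open>
  The eigenvector is \<open>(U\<^sub>0, ..., U\<^sub>h)\<close> at \<open>x/2\<close>: the rows of the path matrix reproduce the Chebyshev
  recursion, except for the last one, which lacks the summand \<open>U\<^sub>h\<^sub>+\<^sub>1\<close> that is assumed to vanish.
\<close>

lemma eigenvalue_path_mat_if_chebU_zero:
  assumes "chebU (h + 1) x = 0"
  shows "eigenvalue (path_mat h) x"
proof -
  define v where "v = vec (h + 1) (\<lambda>k. chebU k x)"
  have row: "(\<Sum>j<h + 1. (if i = j + 1 \<or> j = i + 1 then 1 else 0) * chebU j x) = x * chebU i x"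
    if i: "i < h + 1" for i
  proof -
    \<comment> \<open>Subtraction is truncated, so the row \<open>i = 0\<close> without a left neighbour is treated separately.\<close>
    have "(\<Sum>j<h + 1. (if i = j + 1 \<or> j = i + 1 then 1 else 0) * chebU j x)
        = (\<Sum>j<h + 1. (if j = i - 1 then (if i = 0 then 0 else chebU j x) else 0)
            + (if j = i + 1 then chebU j x else 0))"
      by (rule sum.cong) auto
    also have "\<dots> = (if i = 0 then 0 else chebU (i - 1) x)
        + (if i + 1 < h + 1 then chebU (i + 1) x else 0)"
      using i by (auto simp: sum.distrib)
    also have "(if i + 1 < h + 1 then chebU (i + 1) x else 0) = chebU (i + 1) x"
      using i assms by (cases "i = h") auto
    finally show ?thesis by (cases i) auto
  qed
  have "eigenvector (path_mat h) v x"
    unfolding eigenvector_def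
  proof (intro conjI)
    show "v \<in> carrier_vec (dim_row (path_mat h))" by (simp add: v_def path_mat_def)
    have "vec_index v 0 = 1" by (simp add: v_def)
    then show "v \<noteq> 0\<^sub>v (dim_row (path_mat h))" by (auto simp: path_mat_def)
    show "path_mat h *\<^sub>v v = x \<cdot>\<^sub>v v"
    proof (rule eq_vecI)
      fix i assume "i < dim_vec (x \<cdot>\<^sub>v v)"
      then have i: "i < h + 1" by (simp add: v_def)
      have "vec_index (path_mat h *\<^sub>v v) i
          = (\<Sum>j<h + 1. (if i = j + 1 \<or> j = i + 1 then 1 else 0) * chebU j x)"
        using i unfolding path_mat_def v_def scalar_prod_def
        by (auto simp: scalar_prod_def lessThan_atLeast0 intro!: sum.cong)
      then show "vec_index (path_mat h *\<^sub>v v) i = vec_index (x \<cdot>\<^sub>v v) i"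
        using row[OF i] i by (simp add: v_def)
    qed (simp add: path_mat_def v_def)
  qed
  then show ?thesis unfolding eigenvalue_def by blast
qed

text \<open>
  Every root has order at least 1 and the orders add up to at most the degree, so \<open>degree p\<close>
  distinct roots leave room neither for another root nor for a multiple one.
\<close>

lemma simple_roots_if_card_eq_degree:
  fixes p :: "'a :: idom poly"
  assumes "p \<noteq> 0" and A: "A \<subseteq> {x. poly p x = 0}" and card: "card A = degree p"
  shows "{x. poly p x = 0} = A" and "\<And>x. x \<in> A \<Longrightarrow> Polynomial.order x p = 1"
proof -
  let ?R = "{x. poly p x = 0}"
  have fin: "finite ?R" using poly_roots_finite[OF \<open>p \<noteq> 0\<close>] .
  have pos: "1 \<le> Polynomial.order x p" if "x \<in> ?R" for x
    using that \<open>p \<noteq> 0\<close> order_root[of p x] by (cases "Polynomial.order x p") auto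
  have "(\<Sum>x\<in>?R. Polynomial.order x p) = size (proots p)"
    using \<open>p \<noteq> 0\<close> by (simp add: size_multiset_overloaded_eq)
  then have le: "(\<Sum>x\<in>?R. Polynomial.order x p) \<le> card A"
    using size_proots_le[of p] card by simp
  have "card ?R \<le> (\<Sum>x\<in>?R. Polynomial.order x p)"
    using sum_mono[of ?R "\<lambda>_. 1" "\<lambda>x. Polynomial.order x p"] pos by simp
  then show RA: "?R = A"
    using le A fin by (metis card_seteq order_trans)
  show "Polynomial.order x p = 1" if x: "x \<in> A" for x
  proof (rule ccontr)
    assume "Polynomial.order x p \<noteq> 1"
    then have "(\<Sum>y\<in>?R. 1) < (\<Sum>y\<in>?R. Polynomial.order y p)"
      using x pos fin RA by (intro sum_strict_mono_ex1) (force+)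
    then show False using le RA by simp
  qed
qed

text \<open>
  The numbers \<open>path_root h j\<close> are zeros of \<open>chebU (h + 1)\<close>, these zeros are eigenvalues of \<open>path_mat h\<close>, and a
  matrix of size \<open>h + 1\<close> has no room for more than the \<open>h + 1\<close> distinct numbers at the start of
  this chain. The root orders of the characteristic polynomial thus come without computing a determinant.
\<close>

lemma path_spectrum:
  shows "{x. chebU (h + 1) x = 0} = path_root h ` {1..h + 1}"
    and "{x. eigenvalue (path_mat h) x} = path_root h ` {1..h + 1}"
    and "j \<in> {1..h + 1} \<Longrightarrow> Polynomial.order (path_root h j) (char_poly (path_mat h)) = 1"
proof -
  let ?A = "path_root h ` {1..h + 1}"
  have deg: "degree (char_poly (path_mat h)) = h + 1" "coeff (char_poly (path_mat h)) (h + 1) = 1"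
    using degree_monic_char_poly[OF path_mat_carrier] by auto
  have ev: "{x. eigenvalue (path_mat h) x} = {x. poly (char_poly (path_mat h)) x = 0}"
    using eigenvalue_root_char_poly[OF path_mat_carrier] by blast
  have sub: "?A \<subseteq> {x. chebU (h + 1) x = 0}"
    using chebU_path_root by blast
  have sub': "{x. chebU (h + 1) x = 0} \<subseteq> {x. eigenvalue (path_mat h) x}"
    using eigenvalue_path_mat_if_chebU_zero by blast
  have nz: "char_poly (path_mat h) \<noteq> 0" using deg by auto
  have A: "?A \<subseteq> {x. poly (char_poly (path_mat h)) x = 0}"
    using sub sub' ev by blast
  have card: "card ?A = degree (char_poly (path_mat h))"
    using card_image[OF inj_on_path_root, of h] deg by simp
  note simple = simple_roots_if_card_eq_degree[OF nz A card]
  show "{x. eigenvalue (path_mat h) x} = ?A" using simple(1) ev by simp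
  then show "{x. chebU (h + 1) x = 0} = ?A" using sub sub' by blast
  show "j \<in> {1..h + 1} \<Longrightarrow> Polynomial.order (path_root h j) (char_poly (path_mat h)) = 1"
    using simple(2) by blast
qed

lemma path_measure_eq:
  "path_measure h = sum_measure {1..h + 1} (\<lambda>j. return borel (path_root h j))"
proof (rule measure_eqI)
  show "sets (path_measure h) = sets (sum_measure {1..h + 1} (\<lambda>j. return borel (path_root h j)))"
    by (simp add: path_measure_def eigenvalue_counting_measure_def)
next
  fix X assume "X \<in> sets (path_measure h)"
  then have X: "X \<in> sets borel"
    by (simp add: path_measure_def eigenvalue_counting_measure_def)
  have "emeasure (path_measure h) X = (\<Sum>l\<in>path_root h ` {1..h + 1}.
      of_nat (Polynomial.order l (char_poly (path_mat h))) * indicator X l)"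
    unfolding path_measure_def eigenvalue_counting_measure_def path_spectrum(2)
    using X by (subst emeasure_sum_measure) (auto simp: nn_integral_count_space_finite)
  also have "\<dots> = (\<Sum>j\<in>{1..h + 1}. indicator X (path_root h j))"
    by (subst sum.reindex[OF inj_on_path_root]) (auto simp: path_spectrum(3) intro!: sum.cong)
  also have "\<dots> = emeasure (sum_measure {1..h + 1} (\<lambda>j. return borel (path_root h j))) X"
    using X by (subst emeasure_sum_measure) (auto simp: nn_integral_count_space_finite)
  finally show "emeasure (path_measure h) X =
      emeasure (sum_measure {1..h + 1} (\<lambda>j. return borel (path_root h j))) X" .
qed

section \<open>Truncations of the operator in coordinates\<close>

lemma sum_fun_apply: "(\<Sum>i\<in>A. g i) w = (\<Sum>i\<in>A. g i w)"
  for g :: "'i \<Rightarrow> 'a \<Rightarrow> 'b :: comm_monoid_add"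
  by (induction A rule: infinite_finite_induct) auto

lemma lshift_simps [simp]:
  "lshift i \<xi> [] = 0"
  "lshift i \<xi> (a # v) = (if a = i then \<xi> v else 0)"
proof -
  have "basis_vec [i] (take k (a # v)) * \<xi> (drop k (a # v)) =
      (if k = 1 then (if a = i then \<xi> v else 0) else 0)" if "k \<le> length (a # v)" for k
    using that by (cases k; cases "k - 1"; cases v) (auto simp: basis_vec_def)
  then have "lshift i \<xi> (a # v) =
      (\<Sum>k\<le>length (a # v). if k = 1 then (if a = i then \<xi> v else 0) else 0)"
    unfolding lshift_def tensor_def by (intro sum.cong) auto
  then show "lshift i \<xi> (a # v) = (if a = i then \<xi> v else 0)"
    by (simp del: sum.atMost_Suc)
qed (simp add: lshift_def tensor_def basis_vec_def)

lemma finner_finite_support: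
  assumes "finite A" "\<And>w. w \<notin> A \<Longrightarrow> \<xi> w * cnj (\<eta> w) = 0"
  shows "finner \<xi> \<eta> = (\<Sum>w\<in>A. \<xi> w * cnj (\<eta> w))"
proof -
  have "finner \<xi> \<eta> = infsum (\<lambda>w. \<xi> w * cnj (\<eta> w)) A"
    unfolding finner_def using assms(2) by (intro infsum_cong_neutral) auto
  then show ?thesis using assms(1) by simp
qed

lemma finner_basis_vec_left: "finner (basis_vec w) \<eta> = cnj (\<eta> w)"
  by (subst finner_finite_support[of "{w}"]) (auto simp: basis_vec_def)

lemma finner_basis_vec_right: "finner \<xi> (basis_vec w) = \<xi> w"
  by (subst finner_finite_support[of "{w}"]) (auto simp: basis_vec_def)

lemma finite_support_in_fock:
  assumes "finite A" "A \<subseteq> words d" "\<And>w. w \<notin> A \<Longrightarrow> \<xi> w = 0"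
  shows "\<xi> \<in> fock d"
proof -
  have "(\<lambda>w. (cmod (\<xi> w))\<^sup>2) summable_on UNIV"
    using assms(1,3) by (intro finite_nonzero_values_imp_summable_on) (auto intro: finite_subset)
  then show ?thesis using assms by (auto simp: fock_def)
qed

text \<open>
  Both inner products are the same sum, once over the words \<open>i # w\<close> and once over \<open>w\<close>. Testing
  against basis vectors gives uniqueness.
\<close>

lemma fadjoint_lshift:
  assumes "i \<in> {1..d}" "\<eta> \<in> fock d"
  shows "fadjoint d (lshift i) \<eta> = (\<lambda>w. \<eta> (i # w))"
  unfolding fadjoint_def
proof (rule the_equality)
  have inj: "inj (Cons i)" by simp
  have "(\<lambda>w. (cmod (\<eta> w))\<^sup>2) summable_on range (Cons i)"
    using assms(2) by (auto simp: fock_def intro: summable_on_subset_banach)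
  then have "(\<lambda>w. (cmod (\<eta> (i # w)))\<^sup>2) summable_on UNIV"
    by (simp add: summable_on_reindex[OF inj] o_def)
  moreover have "\<eta> (i # w) = 0" if "w \<notin> words d" for w
    using that assms(2) by (simp add: fock_def words_def)
  moreover have "finner (lshift i \<xi>) \<eta> = finner \<xi> (\<lambda>w. \<eta> (i # w))" for \<xi>
  proof -
    have "lshift i \<xi> w = 0" if "w \<notin> range (Cons i)" for w
      using that by (cases w) auto
    then have "finner (lshift i \<xi>) \<eta> = infsum (\<lambda>w. lshift i \<xi> w * cnj (\<eta> w)) (range (Cons i))"
      unfolding finner_def by (intro infsum_cong_neutral) auto
    then show ?thesis by (simp add: infsum_reindex[OF inj] o_def finner_def)
  qed
  ultimately show adj: "(\<lambda>w. \<eta> (i # w)) \<in> fock d \<and>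
      (\<forall>\<xi>\<in>fock d. finner (lshift i \<xi>) \<eta> = finner \<xi> (\<lambda>w. \<eta> (i # w)))"
    by (simp add: fock_def)
  fix \<zeta> assume \<zeta>: "\<zeta> \<in> fock d \<and> (\<forall>\<xi>\<in>fock d. finner (lshift i \<xi>) \<eta> = finner \<xi> \<zeta>)"
  show "\<zeta> = (\<lambda>w. \<eta> (i # w))"
  proof
    fix w
    show "\<zeta> w = \<eta> (i # w)"
    proof (cases "w \<in> words d")
      case True
      then have "basis_vec w \<in> fock d"
        by (intro finite_support_in_fock[of "{w}"]) (auto simp: basis_vec_def)
      then have "finner (basis_vec w) \<zeta> = finner (basis_vec w) (\<lambda>w. \<eta> (i # w))"
        using \<zeta> adj by metis
      then show ?thesis by (simp add: finner_basis_vec_left)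
    next
      case False
      then show ?thesis using \<zeta> adj by (simp add: fock_def)
    qed
  qed
qed

definition trunc_words :: "nat \<Rightarrow> nat \<Rightarrow> nat list set" where
  "trunc_words d N = {w \<in> words d. length w \<le> N}"

lemma finite_trunc_words [simp]: "finite (trunc_words d N)"
  using finite_lists_length_le[of "{1..d}" N]
  by (auto simp: trunc_words_def words_def lists_eq_set elim!: finite_subset[rotated])

lemma trunc_space_eq: "trunc_space d N = {\<xi>. \<forall>w. w \<notin> trunc_words d N \<longrightarrow> \<xi> w = 0}"
  (is "_ = ?S")
proof
  have "fsp.subspace ?S"
    by (rule fsp.subspaceI) (auto simp: fscale_def)
  then show "trunc_space d N \<subseteq> ?S"
    unfolding trunc_space_def
    by (intro fsp.span_minimal) (auto simp: basis_vec_def trunc_words_def)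
  show "?S \<subseteq> trunc_space d N"
  proof
    fix \<xi> assume \<xi>: "\<xi> \<in> ?S"
    have "\<xi> = (\<Sum>v\<in>trunc_words d N. fscale (\<xi> v) (basis_vec v))"
    proof
      fix w
      have "(\<Sum>v\<in>trunc_words d N. fscale (\<xi> v) (basis_vec v)) w =
          (\<Sum>v\<in>trunc_words d N. if v = w then \<xi> v else 0)"
        unfolding sum_fun_apply by (intro sum.cong) (auto simp: fscale_def basis_vec_def)
      then show "\<xi> w = (\<Sum>v\<in>trunc_words d N. fscale (\<xi> v) (basis_vec v)) w"
        using \<xi> by simp
    qed
    also have "\<dots> \<in> trunc_space d N"
      unfolding trunc_space_def trunc_words_def
      by (intro fsp.span_sum fsp.span_scale fsp.span_base) auto
    finally show "\<xi> \<in> trunc_space d N" .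
  qed
qed

lemma orth_proj_trunc_space:
  "orth_proj (trunc_space d N) \<xi> = (\<lambda>w. if w \<in> trunc_words d N then \<xi> w else 0)"
  unfolding orth_proj_def
proof (rule the_equality)
  let ?\<eta> = "\<lambda>w. if w \<in> trunc_words d N then \<xi> w else 0"
  have "finner (\<xi> - ?\<eta>) \<zeta> = 0" if "\<zeta> \<in> trunc_space d N" for \<zeta>
    using that by (subst finner_finite_support[of "trunc_words d N"]) (auto simp: trunc_space_eq)
  then show "?\<eta> \<in> trunc_space d N \<and> (\<forall>\<zeta>\<in>trunc_space d N. finner (\<xi> - ?\<eta>) \<zeta> = 0)"
    by (auto simp: trunc_space_eq)
  fix \<eta> assume \<eta>: "\<eta> \<in> trunc_space d N \<and> (\<forall>\<zeta>\<in>trunc_space d N. finner (\<xi> - \<eta>) \<zeta> = 0)"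
  show "\<eta> = ?\<eta>"
  proof
    fix w
    show "\<eta> w = ?\<eta> w"
    proof (cases "w \<in> trunc_words d N")
      case True
      then have "basis_vec w \<in> trunc_space d N" by (auto simp: trunc_space_eq basis_vec_def)
      then have "finner (\<xi> - \<eta>) (basis_vec w) = 0" using \<eta> by blast
      then show ?thesis using True by (simp add: finner_basis_vec_right)
    qed (use \<eta> in \<open>auto simp: trunc_space_eq\<close>)
  qed
qed

abbreviation (input) shift_plus_adjoint :: "nat \<Rightarrow> (nat list \<Rightarrow> complex) \<Rightarrow> nat list \<Rightarrow> complex" where
  "shift_plus_adjoint d \<equiv> \<lambda>\<xi>. lshift 1 \<xi> + fadjoint d (lshift 1) \<xi>"

text \<open>
  In coordinates, an eigenvector is a finitely supported function on words that satisfies a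
  difference equation. The value \<open>\<xi> (1 # w)\<close> vanishes when \<open>w\<close> already has length \<open>N\<close>; this is
  the boundary condition at the long end of a chain.
\<close>

lemma trunc_eigenspace_iff:
  assumes "1 \<le> d"
  shows "\<xi> \<in> trunc_eigenspace d N (shift_plus_adjoint d) c \<longleftrightarrow>
    (\<forall>w. w \<notin> trunc_words d N \<longrightarrow> \<xi> w = 0) \<and>
    (\<forall>w\<in>trunc_words d N. lshift 1 \<xi> w + \<xi> (1 # w) = c * \<xi> w)"
proof (cases "\<xi> \<in> trunc_space d N")
  case True
  then have supp: "\<And>w. w \<notin> trunc_words d N \<Longrightarrow> \<xi> w = 0" by (auto simp: trunc_space_eq)
  then have "\<xi> \<in> fock d"
    by (rule finite_support_in_fock[OF finite_trunc_words, rotated]) (auto simp: trunc_words_def)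
  then have adj: "fadjoint d (lshift 1) \<xi> = (\<lambda>w. \<xi> (1 # w))"
    using assms by (intro fadjoint_lshift) auto
  have "orth_proj (trunc_space d N) \<xi> = \<xi>"
    using supp by (auto simp: orth_proj_trunc_space)
  then have "truncation d N (shift_plus_adjoint d) \<xi> =
      (\<lambda>w. if w \<in> trunc_words d N then lshift 1 \<xi> w + \<xi> (1 # w) else 0)"
    by (simp add: truncation_def adj[simplified] orth_proj_trunc_space cong: if_cong)
  then show ?thesis
    using True supp by (auto simp: trunc_eigenspace_def fscale_def fun_eq_iff)
qed (auto simp: trunc_eigenspace_def trunc_space_eq)

section \<open>Chains of words and the eigenspaces\<close>

abbreviation leading_ones :: "nat list \<Rightarrow> nat" where
  "leading_ones w \<equiv> length (takeWhile ((=) 1) w)"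

abbreviation core :: "nat list \<Rightarrow> nat list" where
  "core w \<equiv> dropWhile ((=) 1) w"

lemma replicate_leading_ones_core: "replicate (leading_ones w) 1 @ core w = w"
  by (induction w) auto

lemma length_leading_ones_core: "leading_ones w + length (core w) = length w"
  by (induction w) auto

text \<open>
  Every word is \<open>1\<^sup>k v\<close> for exactly one \<open>k\<close> and one \<open>v\<close> not beginning with 1. These \<open>v\<close>, the fixed
  points of \<open>core\<close>, are the starting points of the chains.
\<close>

definition chain_heads :: "nat \<Rightarrow> nat \<Rightarrow> nat list set" where
  "chain_heads d N = {v \<in> trunc_words d N. core v = v}"

lemma finite_chain_heads [simp]: "finite (chain_heads d N)"
  by (simp add: chain_heads_def)

lemma core_in_chain_heads: "w \<in> trunc_words d N \<Longrightarrow> core w \<in> chain_heads d N"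
  using length_leading_ones_core[of w]
  by (auto simp: chain_heads_def trunc_words_def words_def lists_eq_set dest: set_dropWhileD)

lemma lshift_one_head: "core v = v \<Longrightarrow> lshift 1 \<xi> v = 0"
  using length_leading_ones_core[of v] by (cases v) auto

text \<open>
  An eigenvector is determined along a chain by its value at the head. The case \<open>k = N - length v + 1\<close>
  lies just beyond the chain, where \<open>\<xi>\<close> vanishes; it says that the value at the head is 0 unless
  \<open>chebU (N - length v + 1) l = 0\<close>.
\<close>

lemma eigenvector_on_chain:
  assumes "1 \<le> d" and \<xi>: "\<xi> \<in> trunc_eigenspace d N (shift_plus_adjoint d) (of_real l)"
    and v: "v \<in> chain_heads d N" and "k \<le> N - length v + 1"
  shows "\<xi> (replicate k 1 @ v) = of_real (chebU k l) * \<xi> v"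
  using \<open>k \<le> N - length v + 1\<close>
proof (induction k rule: less_induct)
  case (less k)
  have eq: "lshift 1 \<xi> w + \<xi> (1 # w) = of_real l * \<xi> w" if "w \<in> trunc_words d N" for w
    using \<xi> that trunc_eigenspace_iff[OF \<open>1 \<le> d\<close>] by blast
  have vw: "v \<in> words d" "length v \<le> N" "core v = v"
    using v by (auto simp: chain_heads_def trunc_words_def)
  consider "k = 0" | "k = Suc 0" | m where "k = Suc (Suc m)"
    by (metis not0_implies_Suc)
  then show ?case
  proof cases
    case 1
    then show ?thesis by simp
  next
    case 2
    have "\<xi> (1 # v) = of_real l * \<xi> v"
      using eq[of v] lshift_one_head[OF vw(3), of \<xi>] vw by (simp add: trunc_words_def)
    then show ?thesis using 2 by simp
  next
    case 3
    \<comment> \<open>The equation is used one step below the word in question, which still has length at most \<open>N\<close>.\<close>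
    have "replicate (Suc m) 1 @ v \<in> trunc_words d N"
      using vw less.prems 3 \<open>1 \<le> d\<close> by (auto simp: trunc_words_def words_def lists_eq_set)
    from eq[OF this] have "\<xi> (replicate k 1 @ v) =
        of_real l * \<xi> (replicate (Suc m) 1 @ v) - \<xi> (replicate m 1 @ v)"
      using 3 by (simp add: algebra_simps)
    also have "\<dots> = of_real (chebU k l) * \<xi> v"
      using less.IH[of m] less.IH[of "Suc m"] less.prems 3 by (simp add: algebra_simps)
    finally show ?thesis .
  qed
qed

definition chain_vec :: "nat \<Rightarrow> nat \<Rightarrow> real \<Rightarrow> nat list \<Rightarrow> nat list \<Rightarrow> complex" where
  "chain_vec d N l v = (\<lambda>w. if w \<in> trunc_words d N \<and> core w = v then of_real (chebU (leading_ones w) l) else 0)"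

lemma chain_vec_head:
  assumes "u \<in> chain_heads d N"
  shows "chain_vec d N l v u = (if u = v then 1 else 0)"
proof -
  have "core u = u" "u \<in> trunc_words d N" using assms by (auto simp: chain_heads_def)
  moreover from this have "leading_ones u = 0" using length_leading_ones_core[of u] by simp
  ultimately show ?thesis by (auto simp: chain_vec_def)
qed

text \<open>
  The heads of those chains on which \<open>l\<close> is an eigenvalue.
\<close>

definition resonant_heads :: "nat \<Rightarrow> nat \<Rightarrow> real \<Rightarrow> nat list set" where
  "resonant_heads d N l = {v \<in> chain_heads d N. chebU (N - length v + 1) l = 0}"

lemma finite_resonant_heads [simp]: "finite (resonant_heads d N l)"
  by (simp add: resonant_heads_def)

text \<open>
  The vector with the Chebyshev values on one chain and 0 elsewhere satisfies the recursion inside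
  the chain, and resonance is what makes the equation hold at its last word.
\<close>

lemma chain_vec_in_eigenspace:
  assumes "1 \<le> d" "v \<in> resonant_heads d N l"
  shows "chain_vec d N l v \<in> trunc_eigenspace d N (shift_plus_adjoint d) (of_real l)"
  unfolding trunc_eigenspace_iff[OF \<open>1 \<le> d\<close>]
proof (intro conjI allI impI ballI)
  fix w assume w: "w \<in> trunc_words d N"
  let ?\<xi> = "chain_vec d N l v"
  \<comment> \<open>At a word of length \<open>N\<close> the left-hand side is 0 by truncation, the right-hand side by resonance.\<close>
  have down: "?\<xi> (1 # w) = (if core w = v then of_real (chebU (Suc (leading_ones w)) l) else 0)"
  proof (cases "core w = v \<and> length w = N")
    case True
    then have "Suc (leading_ones w) = N - length v + 1"
      using length_leading_ones_core[of w] by simp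
    then have "chebU (Suc (leading_ones w)) l = 0"
      using assms(2) by (simp add: resonant_heads_def)
    then show ?thesis using True by (simp add: chain_vec_def trunc_words_def)
  next
    case False
    then show ?thesis
      using w \<open>1 \<le> d\<close> by (auto simp: chain_vec_def trunc_words_def words_def)
  qed
  show "lshift 1 ?\<xi> w + ?\<xi> (1 # w) = of_real l * ?\<xi> w"
  proof (cases "\<exists>u. w = 1 # u")
    case True
    then obtain u where u: "w = 1 # u" by blast
    then have "u \<in> trunc_words d N" using w by (auto simp: trunc_words_def words_def)
    then have "lshift 1 ?\<xi> w = (if core w = v then of_real (chebU (leading_ones u) l) else 0)"
      using u by (simp add: chain_vec_def)
    then show ?thesis unfolding down using u w by (simp add: chain_vec_def)
  next
    case False
    then have "leading_ones w = 0" "lshift 1 ?\<xi> w = 0" by (cases w; auto)+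
    then show ?thesis unfolding down using w by (simp add: chain_vec_def)
  qed
qed (auto simp: chain_vec_def)

lemma eigenvector_expansion:
  assumes "1 \<le> d" and \<xi>: "\<xi> \<in> trunc_eigenspace d N (shift_plus_adjoint d) (of_real l)"
  shows "\<xi> = (\<Sum>v\<in>resonant_heads d N l. fscale (\<xi> v) (chain_vec d N l v))"
proof
  fix w
  show "\<xi> w = (\<Sum>v\<in>resonant_heads d N l. fscale (\<xi> v) (chain_vec d N l v)) w"
  proof (cases "w \<in> trunc_words d N")
    case False
    then have "\<xi> w = 0" using \<xi> trunc_eigenspace_iff[OF \<open>1 \<le> d\<close>] by blast
    then show ?thesis using False by (simp add: sum_fun_apply fscale_def chain_vec_def)
  next
    case True
    define v where "v = core w"
    have v: "v \<in> chain_heads d N" using core_in_chain_heads[OF True] by (simp add: v_def)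
    have len: "leading_ones w + length v = length w" "length w \<le> N"
      using length_leading_ones_core[of w] True by (simp_all add: v_def trunc_words_def)
    have chain: "\<xi> (replicate k 1 @ v) = of_real (chebU k l) * \<xi> v" if "k \<le> N - length v + 1" for k
      using eigenvector_on_chain[OF assms v that] .
    have \<xi>w: "\<xi> w = of_real (chebU (leading_ones w) l) * \<xi> v"
      using chain[of "leading_ones w"] len replicate_leading_ones_core[of w] by (simp add: v_def)
    have "\<xi> v = 0" if "v \<notin> resonant_heads d N l"
    proof -
      have "replicate (N - length v + 1) 1 @ v \<notin> trunc_words d N"
        using len by (simp add: trunc_words_def)
      then have "\<xi> (replicate (N - length v + 1) 1 @ v) = 0"
        using \<xi> trunc_eigenspace_iff[OF \<open>1 \<le> d\<close>] by blast
      then show ?thesis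
        using chain[of "N - length v + 1"] that v by (auto simp: resonant_heads_def)
    qed
    moreover have "(\<Sum>u\<in>resonant_heads d N l. fscale (\<xi> u) (chain_vec d N l u)) w =
        (\<Sum>u\<in>resonant_heads d N l. if u = v then \<xi> v * of_real (chebU (leading_ones w) l) else 0)"
      unfolding sum_fun_apply using True
      by (intro sum.cong) (auto simp: fscale_def chain_vec_def v_def)
    ultimately show ?thesis using \<xi>w by simp
  qed
qed

text \<open>
  The vectors \<open>chain_vec d N l v\<close> with resonant head \<open>v\<close> form a basis of the eigenspace: evaluation at
  the heads is a dual system, and an eigenvector is determined by its values there.
\<close>

lemma dim_trunc_eigenspace:
  assumes "1 \<le> d"
  shows "fsp.dim (trunc_eigenspace d N (shift_plus_adjoint d) (of_real l)) = card (resonant_heads d N l)"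
proof -
  let ?R = "resonant_heads d N l" and ?c = "chain_vec d N l"
  let ?E = "trunc_eigenspace d N (shift_plus_adjoint d) (of_real l)"
  have RH: "?R \<subseteq> chain_heads d N" by (auto simp: resonant_heads_def)
  have inj: "inj_on ?c ?R"
  proof (rule inj_onI)
    fix u v assume "u \<in> ?R" "v \<in> ?R" "?c u = ?c v"
    then have "?c u u = ?c v u" "u \<in> chain_heads d N" using RH by auto
    then show "u = v" by (auto simp: chain_vec_head split: if_splits)
  qed
  have "fsp.independent (?c ` ?R)"
  proof (rule fsp.independent_if_scalars_zero)
    fix a x assume sum0: "(\<Sum>x\<in>?c ` ?R. fscale (a x) x) = 0" and "x \<in> ?c ` ?R"
    then obtain v where v: "v \<in> ?R" "x = ?c v" by blast
    have "0 = (\<Sum>u\<in>?R. fscale (a (?c u)) (?c u)) v"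
      using sum0 by (simp add: sum.reindex[OF inj])
    also have "\<dots> = (\<Sum>u\<in>?R. if u = v then a (?c v) else 0)"
      unfolding sum_fun_apply using v RH
      by (intro sum.cong) (auto simp: fscale_def chain_vec_head)
    also have "\<dots> = a x" using v by simp
    finally show "a x = 0" by simp
  qed simp
  moreover have "?c ` ?R \<subseteq> ?E" using chain_vec_in_eigenspace[OF assms] by blast
  moreover have "?E \<subseteq> fsp.span (?c ` ?R)"
  proof
    fix \<xi> assume "\<xi> \<in> ?E"
    then have "\<xi> = (\<Sum>v\<in>?R. fscale (\<xi> v) (?c v))" by (rule eigenvector_expansion[OF assms])
    also have "\<dots> \<in> fsp.span (?c ` ?R)"
      by (intro fsp.span_sum fsp.span_scale fsp.span_base) auto
    finally show "\<xi> \<in> fsp.span (?c ` ?R)" .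
  qed
  ultimately have "card (?c ` ?R) = fsp.dim ?E" by (intro fsp.basis_card_eq_dim)
  then show ?thesis using card_image[OF inj] by simp
qed

lemma trunc_eigenspace_nontrivial_iff:
  assumes "1 \<le> d"
  shows "trunc_eigenspace d N (shift_plus_adjoint d) (of_real l) \<noteq> {0} \<longleftrightarrow> resonant_heads d N l \<noteq> {}"
proof
  assume "resonant_heads d N l \<noteq> {}"
  then obtain v where v: "v \<in> resonant_heads d N l" by blast
  then have "chain_vec d N l v v = 1" by (simp add: chain_vec_head resonant_heads_def)
  then have "chain_vec d N l v \<noteq> 0" by auto
  then show "trunc_eigenspace d N (shift_plus_adjoint d) (of_real l) \<noteq> {0}"
    using chain_vec_in_eigenspace[OF assms v] by blast
next
  assume nontrivial: "trunc_eigenspace d N (shift_plus_adjoint d) (of_real l) \<noteq> {0}"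
  show "resonant_heads d N l \<noteq> {}"
  proof
    assume "resonant_heads d N l = {}"
    then have "\<xi> = 0" if "\<xi> \<in> trunc_eigenspace d N (shift_plus_adjoint d) (of_real l)" for \<xi>
      using eigenvector_expansion[OF assms that] by simp
    moreover have "0 \<in> trunc_eigenspace d N (shift_plus_adjoint d) (of_real l)"
      unfolding trunc_eigenspace_iff[OF assms]
    proof (intro conjI allI impI ballI)
      fix w :: "nat list"
      show "lshift 1 0 w + 0 (1 # w) = complex_of_real l * 0 w" by (cases w) auto
    qed simp
    ultimately show False using nontrivial by blast
  qed
qed

text \<open>
  A nonempty head has \<open>d - 1\<close> choices for its first letter and \<open>d\<close> for every other one.
\<close>

lemma card_chain_heads_of_length:
  assumes "1 \<le> d" "m \<le> N"
  shows "card {v \<in> chain_heads d N. length v = m} = (if m = 0 then 1 else (d - 1) * d ^ (m - 1))"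
proof (cases m)
  case 0
  then have "{v \<in> chain_heads d N. length v = m} = {[]}"
    by (auto simp: chain_heads_def trunc_words_def words_def)
  then show ?thesis using 0 by simp
next
  case (Suc n)
  have "{v \<in> chain_heads d N. length v = m} =
      (\<lambda>(a, u). a # u) ` ({2..d} \<times> {u. set u \<subseteq> {1..d} \<and> length u = n})"
  proof (intro equalityI subsetI)
    fix v assume v: "v \<in> {v \<in> chain_heads d N. length v = m}"
    then obtain a u where au: "v = a # u" using Suc by (cases v) auto
    have "core v = v" "v \<in> words d" using v by (auto simp: chain_heads_def trunc_words_def)
    then have "a \<noteq> 1" "a \<in> {1..d}" "set u \<subseteq> {1..d}"
      using length_leading_ones_core[of v] au by (auto simp: words_def lists_eq_set)
    then have "(a, u) \<in> {2..d} \<times> {u. set u \<subseteq> {1..d} \<and> length u = n}"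
      using v au Suc by auto
    then show "v \<in> (\<lambda>(a, u). a # u) ` ({2..d} \<times> {u. set u \<subseteq> {1..d} \<and> length u = n})"
      using au by force
  next
    fix v assume "v \<in> (\<lambda>(a, u). a # u) ` ({2..d} \<times> {u. set u \<subseteq> {1..d} \<and> length u = n})"
    then obtain a u where v: "v = a # u" "a \<in> {2..d}" "set u \<subseteq> {1..d}" "length u = n"
      by (elim imageE) auto
    then have "set v \<subseteq> {1..d}" "core v = v" by auto
    then show "v \<in> {v \<in> chain_heads d N. length v = m}"
      using v Suc assms by (simp add: chain_heads_def trunc_words_def words_def lists_eq_set)
  qed
  then have "card {v \<in> chain_heads d N. length v = m} =
      card ({2..d} \<times> {u. set u \<subseteq> {1..d} \<and> length u = n})"
    by (simp add: card_image inj_on_def)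
  also have "\<dots> = (d - 1) * d ^ n"
    using card_lists_length_eq[of "{1..d}" n] by (simp add: card_cartesian_product)
  finally show ?thesis using Suc by simp
qed

text \<open>
  Double counting of the pairs of an eigenvalue and a resonant head: summed over the heads, every chain
  contributes the simple spectrum of its path matrix.
\<close>

lemma eigenvalue_sum_over_chain_heads:
  fixes f :: "real \<Rightarrow> complex"
  assumes "1 \<le> d"
  shows "(\<Sum>l | trunc_eigenspace d N (shift_plus_adjoint d) (of_real l) \<noteq> {0}.
            of_nat (fsp.dim (trunc_eigenspace d N (shift_plus_adjoint d) (of_real l))) * f l)
       = (\<Sum>v\<in>chain_heads d N. \<Sum>j = 1..N - length v + 1. f (path_root (N - length v) j))"
proof -
  let ?Z = "\<lambda>v. {l. chebU (N - length v + 1) l = 0}"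
  let ?L = "{l. resonant_heads d N l \<noteq> {}}"
  have "?L = (\<Union>v\<in>chain_heads d N. ?Z v)" by (auto simp: resonant_heads_def)
  then have fin: "finite ?L" by (simp only: path_spectrum(1)) simp
  have "(\<Sum>l | trunc_eigenspace d N (shift_plus_adjoint d) (of_real l) \<noteq> {0}.
            of_nat (fsp.dim (trunc_eigenspace d N (shift_plus_adjoint d) (of_real l))) * f l)
      = (\<Sum>l\<in>?L. of_nat (card (resonant_heads d N l)) * f l)"
    by (simp only: trunc_eigenspace_nontrivial_iff[OF assms] dim_trunc_eigenspace[OF assms])
  also have "\<dots> = (\<Sum>l\<in>?L. \<Sum>v | v \<in> chain_heads d N \<and> l \<in> ?Z v. f l)"
    by (simp add: resonant_heads_def)
  also have "\<dots> = (\<Sum>v\<in>chain_heads d N. \<Sum>l | l \<in> ?L \<and> l \<in> ?Z v. f l)"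
    using fin by (intro sum.swap_restrict) auto
  also have "\<dots> = (\<Sum>v\<in>chain_heads d N. \<Sum>l\<in>?Z v. f l)"
    by (intro sum.cong refl) (auto simp: resonant_heads_def)
  also have "\<dots> = (\<Sum>v\<in>chain_heads d N. \<Sum>j = 1..N - length v + 1. f (path_root (N - length v) j))"
    unfolding path_spectrum(1) by (subst sum.reindex[OF inj_on_path_root]) (simp add: o_def)
  finally show ?thesis .
qed

lemma eigenvalue_sum_by_length:
  fixes f :: "real \<Rightarrow> complex"
  assumes "1 \<le> d"
  defines "g \<equiv> \<lambda>h. \<Sum>j = 1..h + 1. f (path_root h j)"
  shows "(\<Sum>l | trunc_eigenspace d N (shift_plus_adjoint d) (of_real l) \<noteq> {0}.
            of_nat (fsp.dim (trunc_eigenspace d N (shift_plus_adjoint d) (of_real l))) * f l)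
       = g N + (\<Sum>h<N. of_nat ((d - 1) * d ^ (N - Suc h)) * g h)"
proof -
  have "(\<Sum>l | trunc_eigenspace d N (shift_plus_adjoint d) (of_real l) \<noteq> {0}.
            of_nat (fsp.dim (trunc_eigenspace d N (shift_plus_adjoint d) (of_real l))) * f l)
      = (\<Sum>v\<in>chain_heads d N. g (N - length v))"
    unfolding eigenvalue_sum_over_chain_heads[OF assms(1)] g_def ..
  also have "\<dots> = (\<Sum>m\<le>N. \<Sum>v | v \<in> chain_heads d N \<and> length v = m. g (N - length v))"
    by (intro sum.group[OF finite_chain_heads, symmetric]) (auto simp: chain_heads_def trunc_words_def)
  also have "\<dots> = (\<Sum>m\<le>N. of_nat (card {v \<in> chain_heads d N. length v = m}) * g (N - m))"
    by (intro sum.cong refl) simp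
  also have "\<dots> = (\<Sum>m\<le>N. of_nat (if m = 0 then 1 else (d - 1) * d ^ (m - 1)) * g (N - m))"
    using card_chain_heads_of_length[OF assms(1)] by (intro sum.cong refl) simp
  also have "\<dots> = g N + (\<Sum>m<N. of_nat ((d - 1) * d ^ m) * g (N - Suc m))"
    by (simp add: sum.atMost_shift)
  also have "(\<Sum>m<N. of_nat ((d - 1) * d ^ m) * g (N - Suc m)) =
      (\<Sum>h<N. of_nat ((d - 1) * d ^ (N - Suc h)) * g h)"
    by (subst sum.nat_diff_reindex[symmetric]) (intro sum.cong refl, simp add: Suc_diff_Suc)
  finally show ?thesis .
qed

section \<open>Integration against the atomic measure\<close>

text \<open>
  The measure of the theorem, with \<open>q\<close> in place of \<open>1/d\<close>.
\<close>

definition atomic_measure :: "real \<Rightarrow> real measure" where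
  "atomic_measure q = scale_measure (ennreal ((1 - q)\<^sup>2))
     (sum_measure UNIV (\<lambda>h. scale_measure (ennreal (q ^ h)) (path_measure h)))"

lemma nn_integral_count_space_Sigma:
  "(\<integral>\<^sup>+z. f z \<partial>count_space (Sigma A B)) =
   (\<integral>\<^sup>+x. (\<integral>\<^sup>+y. f (x, y) \<partial>count_space (B x)) \<partial>count_space A)"
proof -
  have "(\<integral>\<^sup>+z. f z \<partial>count_space (Sigma A B)) =
      (\<integral>\<^sup>+z. f z * indicator (Sigma A B) z \<partial>count_space UNIV)"
    by (rule nn_integral_count_space_indicator) simp
  also have "\<dots> = (\<integral>\<^sup>+x. (\<integral>\<^sup>+y. f (x, y) * indicator (Sigma A B) (x, y)
      \<partial>count_space UNIV) \<partial>count_space UNIV)"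
    by (rule nn_integral_fst_count_space[symmetric])
  also have "\<dots> = (\<integral>\<^sup>+x. (\<integral>\<^sup>+y. f (x, y) * indicator (B x) y
      \<partial>count_space UNIV) * indicator A x \<partial>count_space UNIV)"
    by (intro nn_integral_cong) (auto simp: indicator_def)
  also have "\<dots> = (\<integral>\<^sup>+x. (\<integral>\<^sup>+y. f (x, y) \<partial>count_space (B x)) \<partial>count_space A)"
    by (simp add: nn_integral_count_space_indicator)
  finally show ?thesis .
qed

lemma sets_path_measure [simp]: "sets (path_measure h) = sets borel"
  by (simp add: path_measure_eq)

lemma sets_atomic_measure [simp]: "sets (atomic_measure q) = sets borel"
  by (simp add: atomic_measure_def)

lemma emeasure_path_measure:
  assumes "X \<in> sets borel"
  shows "emeasure (path_measure h) X = (\<Sum>j = 1..h + 1. indicator X (path_root h j))"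
  unfolding path_measure_eq using assms
  by (subst emeasure_sum_measure) (auto simp: nn_integral_count_space_finite)

lemma emeasure_atomic_measure:
  assumes "X \<in> sets borel"
  shows "emeasure (atomic_measure q) X = ennreal ((1 - q)\<^sup>2) *
    (\<integral>\<^sup>+h. ennreal (q ^ h) * (\<Sum>j = 1..h + 1. indicator X (path_root h j)) \<partial>count_space UNIV)"
  unfolding atomic_measure_def using assms
  by (simp add: emeasure_sum_measure emeasure_path_measure del: sum.cl_ivl_Suc)

text \<open>
  Seen as the image of a weighted counting measure on the index pairs \<open>(h, j)\<close>, the atomic measure
  has integrals that are sums over a countable set.
\<close>

lemma atomic_measure_eq_distr:
  assumes "0 \<le> q"
  shows "atomic_measure q =
    distr (density (count_space (SIGMA h:UNIV. {1..h + 1})) (\<lambda>(h, j). ennreal ((1 - q)\<^sup>2 * q ^ h)))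
      borel (\<lambda>(h, j). path_root h j)"
    (is "_ = distr (density (count_space ?K) ?w) borel ?r")
proof (rule measure_eqI)
  fix X assume "X \<in> sets (atomic_measure q)"
  then have X: "X \<in> sets borel" by simp
  have "emeasure (distr (density (count_space ?K) ?w) borel ?r) X =
      (\<integral>\<^sup>+z. ?w z * indicator (?r -` X) z \<partial>count_space ?K)"
    using X by (subst emeasure_distr)
      (auto simp: emeasure_density intro!: nn_integral_cong split: split_indicator)
  also have "\<dots> = (\<integral>\<^sup>+h. ennreal ((1 - q)\<^sup>2) *
      (ennreal (q ^ h) * (\<Sum>j = 1..h + 1. indicator X (path_root h j))) \<partial>count_space UNIV)"
    unfolding nn_integral_count_space_Sigma
  proof (intro nn_integral_cong)
    fix h :: nat
    have "indicator (?r -` X) (h, j) = (indicator X (path_root h j) :: ennreal)" for j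
      by (auto split: split_indicator)
    then show "(\<integral>\<^sup>+j. ?w (h, j) * indicator (?r -` X) (h, j) \<partial>count_space {1..h + 1}) =
        ennreal ((1 - q)\<^sup>2) * (ennreal (q ^ h) * (\<Sum>j = 1..h + 1. indicator X (path_root h j)))"
      unfolding sum_distrib_left using assms
      by (simp add: nn_integral_count_space_finite ennreal_mult mult.assoc del: sum.cl_ivl_Suc)
  qed
  also have "\<dots> = emeasure (atomic_measure q) X"
    using X by (simp add: emeasure_atomic_measure nn_integral_cmult del: sum.cl_ivl_Suc)
  finally show "emeasure (atomic_measure q) X =
      emeasure (distr (density (count_space ?K) ?w) borel ?r) X" by simp
qed simp

lemma abs_path_root_le: "\<bar>path_root h j\<bar> \<le> 2"
  by (simp add: path_root_def abs_mult)

text \<open>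
  The total mass of the atomic measure before normalisation, as \<open>\<mu>\<^sub>h\<close> has mass \<open>h + 1\<close>.
\<close>

lemma sums_Suc_times_power:
  fixes q :: real
  assumes "0 \<le> q" "q < 1"
  shows "(\<lambda>h. real (h + 1) * q ^ h) sums (1 / (1 - q)\<^sup>2)"
  using geometric_deriv_sums[of q] assms by simp

text \<open>
  All atoms lie in \<open>[-2, 2]\<close>, where a continuous function is bounded; the series is
  therefore dominated by a multiple of \<open>\<Sum> (h + 1) q\<^sup>h\<close>.
\<close>

lemma integral_atomic_measure:
  fixes f :: "real \<Rightarrow> complex"
  assumes q: "0 \<le> q" "q < 1" and f: "continuous_on UNIV f"
  shows "integrable (atomic_measure q) f"
    and "(\<lambda>h. of_real ((1 - q)\<^sup>2 * q ^ h) * (\<Sum>j = 1..h + 1. f (path_root h j))) sums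
           (LINT x|atomic_measure q. f x)"
proof -
  let ?K = "SIGMA h:(UNIV :: nat set). {1..h + 1}"
  let ?w = "\<lambda>(h, j :: nat). (1 - q)\<^sup>2 * q ^ h"
  let ?r = "\<lambda>(h, j). path_root h j"
  let ?F = "\<lambda>z. ?w z *\<^sub>R f (?r z)"
  have meas [measurable]: "f \<in> borel_measurable borel"
    using f by (rule borel_measurable_continuous_onI)
  have w0: "AE z in count_space ?K. 0 \<le> ?w z" using q by auto
  have eq: "atomic_measure q = distr (density (count_space ?K) (\<lambda>z. ennreal (?w z))) borel ?r"
    using atomic_measure_eq_distr[OF q(1)] by (simp add: case_prod_unfold)
  have "compact (f ` {-2..2})"
    using f by (intro compact_continuous_image) (auto intro: continuous_on_subset)
  then obtain M where M: "\<And>x. x \<in> {-2..2} \<Longrightarrow> norm (f x) \<le> M"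
    by (meson bounded_iff compact_imp_bounded imageI)
  have fr: "norm (f (path_root h j)) \<le> M" for h j
    using M abs_path_root_le[of h j] by (auto simp: abs_le_iff)
  have summable: "Infinite_Set_Sum.abs_summable_on ?F ?K"
  proof (subst Infinite_Set_Sum.abs_summable_on_Sigma_iff; (intro conjI ballI)?)
    show "Infinite_Set_Sum.abs_summable_on (\<lambda>h. infsetsum (\<lambda>j. norm (?F (h, j))) {1..h + 1}) UNIV"
      unfolding Infinite_Set_Sum.abs_summable_on_nat_iff'
    proof (rule summable_comparison_test'[where N = 0])
      show "summable (\<lambda>h. (1 - q)\<^sup>2 * M * (real (h + 1) * q ^ h))"
        using sums_Suc_times_power[OF q] by (intro summable_mult) (auto simp: sums_iff)
      fix h :: nat
      have "norm (infsetsum (\<lambda>j. norm (?F (h, j))) {1..h + 1}) =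
          (\<Sum>j = 1..h + 1. (1 - q)\<^sup>2 * q ^ h * norm (f (path_root h j)))"
        using q by (simp add: sum_nonneg abs_mult del: sum.cl_ivl_Suc)
      also have "\<dots> \<le> (\<Sum>j = 1..h + 1. (1 - q)\<^sup>2 * q ^ h * M)"
        using q fr by (intro sum_mono mult_left_mono) auto
      also have "\<dots> = (1 - q)\<^sup>2 * M * (real (h + 1) * q ^ h)"
        by (simp add: algebra_simps)
      finally show "norm (norm (infsetsum (\<lambda>j. norm (?F (h, j))) {1..h + 1}))
          \<le> (1 - q)\<^sup>2 * M * (real (h + 1) * q ^ h)"
        by (simp only: real_norm_def abs_idempotent)
    qed
  qed auto
  show "integrable (atomic_measure q) f"
    unfolding eq using summable
    by (subst integrable_distr_eq, simp, simp, subst integrable_density[OF _ _ w0])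
      (simp_all add: Infinite_Set_Sum.abs_summable_on_def)
  have "(LINT x|atomic_measure q. f x) = infsetsum ?F ?K"
    unfolding eq
    by (subst integral_distr, simp, simp, subst integral_density[OF _ _ w0])
      (simp_all add: infsetsum_def)
  also have "\<dots> = infsetsum (\<lambda>h. infsetsum (\<lambda>j. ?F (h, j)) {1..h + 1}) UNIV"
    using summable by (intro infsetsum_Sigma) auto
  also have "\<dots> = infsetsum (\<lambda>h. of_real ((1 - q)\<^sup>2 * q ^ h) * (\<Sum>j = 1..h + 1. f (path_root h j))) UNIV"
    by (simp add: scaleR_conv_of_real sum_distrib_left del: sum.cl_ivl_Suc)
  finally have int: "(LINT x|atomic_measure q. f x) =
      infsetsum (\<lambda>h. of_real ((1 - q)\<^sup>2 * q ^ h) * (\<Sum>j = 1..h + 1. f (path_root h j))) UNIV" .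
  have "Infinite_Set_Sum.abs_summable_on (\<lambda>h. infsetsum (\<lambda>j. ?F (h, j)) {1..h + 1}) UNIV"
    using summable by (intro Infinite_Set_Sum.abs_summable_on_Sigma_project1') (auto simp: case_prod_unfold)
  then have "Infinite_Set_Sum.abs_summable_on
      (\<lambda>h. of_real ((1 - q)\<^sup>2 * q ^ h) * (\<Sum>j = 1..h + 1. f (path_root h j))) UNIV"
    by (simp add: scaleR_conv_of_real sum_distrib_left del: sum.cl_ivl_Suc)
  from sums_infsetsum_nat'[OF this]
  show "(\<lambda>h. of_real ((1 - q)\<^sup>2 * q ^ h) * (\<Sum>j = 1..h + 1. f (path_root h j))) sums
           (LINT x|atomic_measure q. f x)"
    unfolding int .
qed

lemma prob_space_atomic_measure:
  assumes q: "0 \<le> q" "q < 1"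
  shows "prob_space (atomic_measure q)"
proof -
  let ?M = "atomic_measure q"
  have one: "integrable ?M (\<lambda>_. 1 :: complex)"
    by (rule integral_atomic_measure[OF q]) simp
  have "(\<lambda>h. complex_of_real ((1 - q)\<^sup>2 * (real (h + 1) * q ^ h))) sums
      complex_of_real ((1 - q)\<^sup>2 * (1 / (1 - q)\<^sup>2))"
    by (intro sums_of_real sums_mult sums_Suc_times_power q)
  then have "(\<lambda>h. complex_of_real ((1 - q)\<^sup>2 * q ^ h) * (\<Sum>j = 1..h + 1. 1)) sums 1"
    using q by (simp add: mult_ac)
  moreover have "(\<lambda>h. complex_of_real ((1 - q)\<^sup>2 * q ^ h) * (\<Sum>j = 1..h + 1. 1)) sums (LINT x|?M. 1)"
    by (rule integral_atomic_measure(2)[OF q]) simp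
  ultimately have "(LINT x|?M. (1 :: complex)) = 1" by (rule sums_unique2[symmetric])
  then have "complex_of_real (measure ?M (space ?M)) = 1" by (simp add: scaleR_conv_of_real)
  moreover have "emeasure ?M (space ?M) \<noteq> \<infinity>"
    using one by (auto simp: integrable_iff_bounded)
  ultimately show ?thesis
    by (intro prob_spaceI) (simp add: emeasure_eq_ennreal_measure)
qed

lemma emeasure_atomic_measure_off_atoms:
  "emeasure (atomic_measure q) (- range (\<lambda>(h, j). path_root h j)) = 0"
proof -
  have "countable (range (\<lambda>(h, j). path_root h j))" by simp
  then have "- range (\<lambda>(h, j). path_root h j) \<in> sets borel"
    by (intro borel_comp, rule sets.countable[rotated]) auto
  moreover have "indicator (- range (\<lambda>(h, j). path_root h j)) (path_root h j) = (0 :: ennreal)" for h j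
    by (auto simp: indicator_def)
  ultimately show ?thesis by (simp add: emeasure_atomic_measure)
qed

section \<open>The limit of the eigenvalue averages\<close>

text \<open>
  The functions \<open>x \<mapsto> exp(itx)\<close> are continuous, so both measures have the same characteristic function.
\<close>

lemma limiting_eigenvalue_distribution_unique:
  assumes M: "is_limiting_eigenvalue_distribution d T M" and M': "is_limiting_eigenvalue_distribution d T M'"
  shows "M = M'"
proof (rule Levy_uniqueness)
  show "real_distribution M" "real_distribution M'"
    using assms unfolding is_limiting_eigenvalue_distribution_def real_distribution_def
      real_distribution_axioms_def by auto
  show "char M = char M'"
  proof
    fix t
    have "continuous_on UNIV (\<lambda>x. iexp (t * x))" by (intro continuous_intros)
    then have "(LINT x|M. iexp (t * x)) = (LINT x|M'. iexp (t * x))"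
      using M M' unfolding is_limiting_eigenvalue_distribution_def by (blast intro: LIMSEQ_unique)
    then show "char M t = char M' t" by (simp add: char_def)
  qed
qed

lemma geometric_partial_sum_ratio:
  fixes d N :: nat
  assumes "2 \<le> d"
  defines "q \<equiv> 1 / real d"
  shows "real (\<Sum>k\<le>N. d ^ k) = real d ^ N * (1 - q ^ Suc N) / (1 - q)"
proof -
  have d: "real d \<noteq> 0" "real d \<noteq> 1" using assms by auto
  have "real (\<Sum>k\<le>N. d ^ k) = (1 - real d ^ Suc N) / (1 - real d)"
    using d by (simp add: sum_gp0)
  also have "\<dots> = real d ^ N * (1 - q ^ Suc N) / (1 - q)"
    using d by (simp add: q_def divide_simps power_divide) (simp add: algebra_simps)
  finally show ?thesis .
qed

text \<open>
  The number of chains with \<open>h + 1\<close> vertices is \<open>(d - 1) d\<^sup>N\<^sup>-\<^sup>1\<^sup>-\<^sup>h\<close> for \<open>h < N\<close>, which divided by \<open>d\<^sub>N\<close> is exactly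
  \<open>(1 - q)\<^sup>2 q\<^sup>h / (1 - q\<^sup>N\<^sup>+\<^sup>1)\<close>. The single chain starting at the empty word has \<open>h = N\<close> and
  carries \<open>1/(1 - q)\<close> times the weight that this formula would give.
\<close>

lemma eigenvalue_average:
  fixes f :: "real \<Rightarrow> complex" and d N :: nat
  assumes "2 \<le> d"
  defines "q \<equiv> 1 / real d"
  defines "s \<equiv> \<lambda>h. of_real ((1 - q)\<^sup>2 * q ^ h) * (\<Sum>j = 1..h + 1. f (path_root h j))"
  shows "(\<Sum>l | trunc_eigenspace d N (shift_plus_adjoint d) (of_real l) \<noteq> {0}.
            of_nat (fsp.dim (trunc_eigenspace d N (shift_plus_adjoint d) (of_real l))) * f l)
           / of_nat (\<Sum>k\<le>N. d ^ k)
       = ((\<Sum>h<N. s h) + s N / of_real (1 - q)) / of_real (1 - q ^ Suc N)"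
proof -
  define g where "g h = (\<Sum>j = 1..h + 1. f (path_root h j))" for h
  define D where "D = real (\<Sum>k\<le>N. d ^ k)"
  have q: "0 < q" "q < 1" and dq: "real d = 1 / q" using assms by (auto simp: q_def)
  have "q ^ Suc N < 1" using q by (intro power_Suc_less_one) auto
  then have qN: "1 - q ^ Suc N \<noteq> 0" by simp
  have D: "D = (1 / q) ^ N * (1 - q ^ Suc N) / (1 - q)"
    using geometric_partial_sum_ratio[OF assms(1), of N] by (simp add: D_def q_def)
  have inner: "real ((d - 1) * d ^ (N - Suc h)) / D = (1 - q)\<^sup>2 * q ^ h / (1 - q ^ Suc N)"
    if "h < N" for h
  proof -
    define a B where "a = (1 / q) ^ (N - Suc h)" and "B = 1 - q ^ Suc N"
    have nz: "a \<noteq> 0" "B \<noteq> 0" "q ^ h \<noteq> 0" "1 - q \<noteq> 0" "q \<noteq> 0"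
      using q qN by (simp_all add: a_def B_def)
    have num: "real ((d - 1) * d ^ (N - Suc h)) = (1 - q) / q * a"
      using assms(1) q by (simp add: a_def of_nat_diff dq field_simps)
    have "(1 / q) ^ N = (1 / q) ^ ((N - Suc h) + Suc h)"
      using that by simp
    also have "\<dots> = a / q / q ^ h"
      by (simp only: power_add a_def) (simp add: power_divide)
    finally have den: "D = a / q / q ^ h * B / (1 - q)"
      by (simp only: D B_def)
    show ?thesis
      unfolding num den B_def[symmetric] using nz by (simp add: field_simps power2_eq_square)
  qed
  have outer: "1 / D = (1 - q)\<^sup>2 * q ^ N / (1 - q) / (1 - q ^ Suc N)"
  proof -
    define a B where "a = q ^ N" and "B = 1 - q ^ Suc N"
    have nz: "a \<noteq> 0" "B \<noteq> 0" "1 - q \<noteq> 0" using q qN by (simp_all add: a_def B_def)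
    have "D = 1 / a * B / (1 - q)" by (simp only: D B_def a_def power_one_over)
    then show ?thesis
      unfolding a_def[symmetric] B_def[symmetric] using nz by (simp add: power2_eq_square)
  qed
  have "(\<Sum>l | trunc_eigenspace d N (shift_plus_adjoint d) (of_real l) \<noteq> {0}.
            of_nat (fsp.dim (trunc_eigenspace d N (shift_plus_adjoint d) (of_real l))) * f l)
           / of_nat (\<Sum>k\<le>N. d ^ k)
      = (g N + (\<Sum>h<N. of_nat ((d - 1) * d ^ (N - Suc h)) * g h)) / of_real D"
    using eigenvalue_sum_by_length[of d N f] assms(1) by (simp add: g_def D_def)
  also have "\<dots> = of_real (1 / D) * g N +
      (\<Sum>h<N. of_real (real ((d - 1) * d ^ (N - Suc h)) / D) * g h)"
    by (simp add: add_divide_distrib sum_divide_distrib)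
  also have "(\<Sum>h<N. of_real (real ((d - 1) * d ^ (N - Suc h)) / D) * g h) =
      (\<Sum>h<N. s h) / of_real (1 - q ^ Suc N)"
    unfolding sum_divide_distrib using inner by (intro sum.cong) (simp_all add: s_def g_def)
  also have "of_real (1 / D) * g N = s N / of_real (1 - q) / of_real (1 - q ^ Suc N)"
    unfolding outer s_def g_def by simp
  finally show ?thesis by (simp only: add_divide_distrib add.commute)
qed

lemma is_limiting_eigenvalue_distribution_atomic_measure:
  assumes "2 \<le> d"
  shows "is_limiting_eigenvalue_distribution d (shift_plus_adjoint d) (atomic_measure (1 / real d))"
proof -
  let ?q = "1 / real d"
  have q: "0 \<le> ?q" "?q < 1" using assms by auto
  have conv: "(\<lambda>N. (\<Sum>l | trunc_eigenspace d N (shift_plus_adjoint d) (of_real l) \<noteq> {0}.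
            of_nat (fsp.dim (trunc_eigenspace d N (shift_plus_adjoint d) (of_real l))) * f l)
           / of_nat (\<Sum>k\<le>N. d ^ k)) \<longlonglongrightarrow> (LINT x|atomic_measure ?q. f x)"
    if f: "continuous_on UNIV f" for f :: "real \<Rightarrow> complex"
  proof -
    let ?s = "\<lambda>h. of_real ((1 - ?q)\<^sup>2 * ?q ^ h) * (\<Sum>j = 1..h + 1. f (path_root h j))"
    have sums: "?s sums (LINT x|atomic_measure ?q. f x)"
      by (rule integral_atomic_measure(2)[OF q f])
    have "(\<lambda>N. ?q ^ Suc N) \<longlonglongrightarrow> 0"
      using q by (intro LIMSEQ_Suc LIMSEQ_power_zero) simp
    then have "(\<lambda>N. complex_of_real (1 - ?q ^ Suc N)) \<longlonglongrightarrow> of_real (1 - 0)"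
      by (intro tendsto_of_real tendsto_diff tendsto_const)
    moreover have "?s \<longlonglongrightarrow> 0" using sums by (intro summable_LIMSEQ_zero) (rule sums_summable)
    ultimately have "(\<lambda>N. ((\<Sum>h<N. ?s h) + ?s N / of_real (1 - ?q)) / complex_of_real (1 - ?q ^ Suc N))
        \<longlonglongrightarrow> ((LINT x|atomic_measure ?q. f x) + 0 / of_real (1 - ?q)) / of_real (1 - 0)"
      using sums[unfolded sums_def] q
      by (intro tendsto_divide tendsto_add tendsto_const) auto
    then show ?thesis unfolding eigenvalue_average[OF assms] by simp
  qed
  show ?thesis
    unfolding is_limiting_eigenvalue_distribution_def
    using prob_space_atomic_measure[OF q] integral_atomic_measure(1)[OF q] conv by simp
qed

theorem theorem3p1:
  fixes d :: nat and T :: "(nat list \<Rightarrow> complex) \<Rightarrow> (nat list \<Rightarrow> complex)"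
  assumes "2 \<le> d"
    and "T = (\<lambda>\<xi>. lshift 1 \<xi> + fadjoint d (lshift 1) \<xi>)"
  shows "(\<exists>!\<mu>. is_limiting_eigenvalue_distribution d T \<mu>) \<and>
    (\<exists>S. countable S \<and> emeasure (limiting_eigenvalue_distribution d T) (- S) = 0) \<and>
    limiting_eigenvalue_distribution d T =
      scale_measure (ennreal ((1 - 1 / real d)\<^sup>2))
        (sum_measure UNIV (\<lambda>h. scale_measure (ennreal ((1 / real d) ^ h)) (path_measure h))) \<and>
    (\<forall>h. path_measure h =
      sum_measure {1..h + 1} (\<lambda>j. return borel (2 * cos (real j * pi / real (h + 2)))))"
proof -
  let ?\<mu> = "atomic_measure (1 / real d)"
  have lim: "is_limiting_eigenvalue_distribution d T ?\<mu>"
    unfolding assms(2) by (rule is_limiting_eigenvalue_distribution_atomic_measure[OF assms(1)])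
  then have ex1: "\<exists>!\<mu>. is_limiting_eigenvalue_distribution d T \<mu>"
    using limiting_eigenvalue_distribution_unique by blast
  then have eq: "limiting_eigenvalue_distribution d T = ?\<mu>"
    unfolding limiting_eigenvalue_distribution_def using lim by (rule the1_equality)
  have "countable (range (\<lambda>(h, j). path_root h j))" by simp
  then have "\<exists>S. countable S \<and> emeasure ?\<mu> (- S) = 0"
    using emeasure_atomic_measure_off_atoms by blast
  then show ?thesis
    using ex1 eq path_measure_eq unfolding atomic_measure_def path_root_def path_angle_def by simp
qed

end
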